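(* Let $X$ be a discrete random variable with finite support $S$ of cardinality $N$ and with corresponding probability vector $\mathbf p=(p_1,\dots,p_N)$, and let $\alpha>0$, $\alpha\ne1$. Then $$S_\alpha(X)+JS_\alpha(X)=\sum_{i=1}^N S_\alpha(p_i,1-p_i)=\sum_{i=1}^N JS_\alpha(p_i,1-p_i),$$ where $S_\alpha(p_i,1-p_i)$ and $JS_\alpha(p_i,1-p_i)$ are the Tsallis entropy and Tsallis extropy of a discrete random variable taking on two values with corresponding probabilities $(p_i,1-p_i)$.
   Context: $X$ has support $S=\{x_1,\dots,x_N\}$ and $p_i=\mathbb P(X=x_i)\ge 0$, $\sum_{i=1}^N p_i=1$. For $\alpha>0$, $\alpha\neq1$, the Tsallis entropy and the Tsallis extropy of a discrete random variable taking $N$ values with probabilities $(p_1,\dots,p_N)$ are $$S_\alpha(X)=\frac{1}{\alpha-1}\left(1-\sum_{i=1}^N p_i^\alpha\right),\qquad JS_\alpha(X)=\frac{1}{\alpha-1}\left(N-1-\sum_{i=1}^N(1-p_i)^\alpha\right).$$ *)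

theory Defs
  imports "HOL-Probability.Probability"
begin

text \<open>
  A probability vector \<open>(p\<^sub>1, \<dots>, p\<^sub>N)\<close> is a list of length \<open>N\<close>. Entries may be zero; then
  \<open>0 powr \<alpha> = 0\<close>, which is the usual value of \<open>0\<close> to the power \<open>\<alpha>\<close> for \<open>\<alpha> > 0\<close>.
\<close>

definition tsallis_entropy :: "real \<Rightarrow> real list \<Rightarrow> real" where
  "tsallis_entropy \<alpha> ps = 1 / (\<alpha> - 1) * (1 - (\<Sum>p\<leftarrow>ps. p powr \<alpha>))"

definition tsallis_extropy :: "real \<Rightarrow> real list \<Rightarrow> real" where
  "tsallis_extropy \<alpha> ps =
     1 / (\<alpha> - 1) * (real (length ps) - 1 - (\<Sum>p\<leftarrow>ps. (1 - p) powr \<alpha>))"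

text \<open>
  The list \<open>xs\<close> enumerates the support of \<open>X\<close> without repetition. Both quantities in
  \<open>rv_tsallis_entropy\<close> and \<open>rv_tsallis_extropy\<close> are independent of the order of enumeration.
\<close>

definition prob_vector :: "'a measure \<Rightarrow> ('a \<Rightarrow> 'b) \<Rightarrow> 'b list \<Rightarrow> real list" where
  "prob_vector M X xs = map (\<lambda>x. measure M {\<omega> \<in> space M. X \<omega> = x}) xs"

definition rv_tsallis_entropy :: "real \<Rightarrow> 'a measure \<Rightarrow> ('a \<Rightarrow> 'b) \<Rightarrow> 'b list \<Rightarrow> real" where
  "rv_tsallis_entropy \<alpha> M X xs = tsallis_entropy \<alpha> (prob_vector M X xs)"

definition rv_tsallis_extropy :: "real \<Rightarrow> 'a measure \<Rightarrow> ('a \<Rightarrow> 'b) \<Rightarrow> 'b list \<Rightarrow> real" where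
  "rv_tsallis_extropy \<alpha> M X xs = tsallis_extropy \<alpha> (prob_vector M X xs)"

end

theory Submission
  imports Defs
begin

text \<open>
  In the entropy plus the extropy the constants \<open>1\<close> and \<open>N - 1\<close> combine to \<open>N\<close>, so each of the
  \<open>N\<close> outcomes can be given a constant \<open>1\<close> of its own. The sum then splits outcome by outcome into
  the terms \<open>1 - p\<^sub>i powr \<alpha> - (1 - p\<^sub>i) powr \<alpha>\<close>, each of which is, up to the common factor
  \<open>1 / (\<alpha> - 1)\<close>, the entropy of the pair \<open>(p\<^sub>i, 1 - p\<^sub>i)\<close>. Complementing both entries of such a
  pair only swaps them, which is why its extropy is the same number
  (\<open>tsallis_extropy_pair\<close>). For a random variable the number of outcomes is
  the length of its probability vector because the support is enumerated without repetition.
\<close>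

lemma tsallis_extropy_pair:
  "tsallis_extropy \<alpha> [q, 1 - q] = tsallis_entropy \<alpha> [q, 1 - q]"
  by (simp add: tsallis_extropy_def tsallis_entropy_def algebra_simps)

text \<open>
  A new entry \<open>q\<close> takes away \<open>q powr \<alpha>\<close> from the entropy's bracket and \<open>(1 - q) powr \<alpha>\<close> from
  the extropy's, and raises the constant of the latter by \<open>1\<close>, so the sum grows by the entropy of
  \<open>(q, 1 - q)\<close>. For the empty list the constants \<open>1\<close> and \<open>-1\<close> cancel.
\<close>

lemma tsallis_entropy_plus_extropy:
  "tsallis_entropy \<alpha> ps + tsallis_extropy \<alpha> ps = (\<Sum>q\<leftarrow>ps. tsallis_entropy \<alpha> [q, 1 - q])"
proof (induction ps)
  case Nil
  show ?case
    by (simp add: tsallis_entropy_def tsallis_extropy_def flip: distrib_left)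
next
  case (Cons q ps)
  have "tsallis_entropy \<alpha> (q # ps) + tsallis_extropy \<alpha> (q # ps)
      = tsallis_entropy \<alpha> [q, 1 - q] + (tsallis_entropy \<alpha> ps + tsallis_extropy \<alpha> ps)"
    by (simp add: tsallis_entropy_def tsallis_extropy_def flip: distrib_left add_divide_distrib)
  then show ?case
    by (simp add: Cons.IH)
qed

theorem proposition2p3:
  fixes M :: "'a measure" and E :: "'b measure" and X :: "'a \<Rightarrow> 'b"
    and S :: "'b set" and xs :: "'b list" and N :: nat and p :: "real list" and \<alpha> :: real
  assumes "prob_space M"
    and "X \<in> measurable M E"
    and "\<And>x. x \<in> S \<Longrightarrow> {x} \<in> sets E"
    and "AE \<omega> in M. X \<omega> \<in> S"
    and "distinct xs" and "set xs = S" and "card S = N"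
    and "p = prob_vector M X xs"
    and "\<alpha> > 0" and "\<alpha> \<noteq> 1"
  shows "rv_tsallis_entropy \<alpha> M X xs + rv_tsallis_extropy \<alpha> M X xs
           = (\<Sum>i<N. tsallis_entropy \<alpha> [p ! i, 1 - p ! i])
       \<and> (\<Sum>i<N. tsallis_entropy \<alpha> [p ! i, 1 - p ! i])
           = (\<Sum>i<N. tsallis_extropy \<alpha> [p ! i, 1 - p ! i])"
proof -
  have len: "length p = N"
    using assms by (auto simp: prob_vector_def distinct_card)
  have "rv_tsallis_entropy \<alpha> M X xs + rv_tsallis_extropy \<alpha> M X xs
      = (\<Sum>q\<leftarrow>p. tsallis_entropy \<alpha> [q, 1 - q])"
    unfolding rv_tsallis_entropy_def rv_tsallis_extropy_def \<open>p = prob_vector M X xs\<close>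
    by (rule tsallis_entropy_plus_extropy)
  also have "\<dots> = (\<Sum>i<N. tsallis_entropy \<alpha> [p ! i, 1 - p ! i])"
    by (simp add: sum_list_sum_nth len atLeast0LessThan)
  finally show ?thesis
    by (simp add: tsallis_extropy_pair)
qed

end
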